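(* Let $n\ge 3$, let $\Gamma$ be a tree on the $n+1$ vertices $v_1,\dots,v_{n+1}$, labelled so that $v_{n+1}$ is a pendant vertex of $\Gamma$, and let $v_r$ be the unique vertex of $\Gamma$ adjacent to $v_{n+1}$. Let $A=(a_{ij})\in\mathbf{M}_{n+1}(\mathbb{R})$ be a singular matrix satisfying the $\Gamma$-treeangle property, such that for every edge $\{v_i,v_j\}\in E(\Gamma)$ at least one of $a_{ij},a_{ji}$ is nonzero. Suppose that $a_{ii}\ne 0$ for all interior vertices $v_i$ of $\Gamma$, and that the leading principal submatrix $B\in\mathbf{M}_n(\mathbb{R})$ of $A$ (obtained by deleting the $(n+1)$-th row and column of $A$) is invertible. Let $G:=G(A^\dagger)$ be the graph associated with the Moore-Penrose inverse $A^\dagger$. Let $N(v_r)$ be the neighbourhood of $v_r$ in $\Gamma$, and define the sets of edges $$N'_r:=\{\{v_j,v_{n+1}\}: v_j\in N(v_r)\setminus\{v_{n+1}\}\text{ and }a_{jr}\neq 0\},$$ $$N''_r:=\{\{v_j,v_{n+1}\}: v_j\in N(v_r)\setminus\{v_{n+1}\}\text{ and }a_{rj}\neq 0\}.$$ Define the set of edges $H$ as follows: (a) if $a_{r(n+1)}\neq 0$ and $a_{(n+1)r}=0$, then $H:=N''_r$; (b) if $a_{(n+1)r}\neq 0$ and $a_{r(n+1)}=0$, then $H:=N'_r$; (c) if both $a_{r(n+1)}$ and $a_{(n+1)r}$ are nonzero, then $H:=N'_r\cup N''_r$. Put $d_{ij}=a_{ii}a_{jj}-a_{ij}a_{ji}$.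 Then the following hold. (1) $d_{ij}\neq 0$ whenever $\{v_i,v_j\}\in E(\Gamma\setminus\{v_{n+1}\})$. (2) Let $$s_r=\frac{1}{a_{rr}}\Big(1+\sum_{k:\ v_k\in N(v_r),\ k\neq n+1}\frac{a_{rk}a_{kr}}{d_{rk}}\Big).$$ (i) If $s_r\neq 0$, then $E(G)=E(\Gamma)\cup H$. (ii) If $s_r=0$, then $E(G)=\big(E(\Gamma)\setminus\{\{v_r,v_{n+1}\}\}\big)\cup H$.
   Context: All graphs are simple and undirected. $\mathbf{M}_m(\mathbb{R})$ is the set of real $m\times m$ matrices. $E(\Gamma)$ is the edge set of $\Gamma$; $N(v)$ is the set of vertices adjacent to $v$, and $d(v)=|N(v)|$. A vertex $v$ is pendant if $d(v)=1$ and interior if $d(v)>1$. $\Gamma\setminus\{v\}$ is the graph obtained by deleting the vertex $v$ and all edges incident to it. For a tree $\Gamma$ on vertices $v_1,\dots,v_m$, a matrix $A=(a_{ij})\in\mathbf{M}_m(\mathbb{R})$ satisfies the $\Gamma$-treeangle property if $a_{ij}a_{kk}=a_{ik}a_{kj}$ for every triplet of vertices $v_i,v_j,v_k$ such that $v_k$ lies in the (unique) path joining $v_i$ and $v_j$ in $\Gamma$. For $C=(c_{ij})\in\mathbf{M}_m(\mathbb{R})$, the graph $G(C)$ associated with $C$ has vertex set $\{v_1,\dots,v_m\}$, and for $i\ne j$, $\{v_i,v_j\}$ is an edge if and only if at least one of $c_{ij},c_{ji}$ is nonzero. The Moore-Penrose inverse $A^\dagger$ of a square real matrix $A$ is the unique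 matrix $X$ with $AXA=A$, $XAX=X$, $(AX)^T=AX$, $(XA)^T=XA$. *)

theory Defs
  imports "Jordan_Normal_Form.Determinant"
begin

section \<open>Simple undirected graphs\<close>

text \<open>Edges are two-element vertex sets. The trees of the AFP entry Graph Theory cannot be used:
  there \<open>forest\<close> forbids directed cycles of length 2 as well, so a symmetric digraph with at least
  one edge is never a \<open>tree\<close>.\<close>

record 'a ugraph =
  verts :: "'a set"
  edges :: "'a set set"

definition simple_graph :: "'a ugraph \<Rightarrow> bool" where
  "simple_graph G \<longleftrightarrow> finite (verts G) \<and>
     edges G \<subseteq> {{u, v} | u v. u \<in> verts G \<and> v \<in> verts G \<and> u \<noteq> v}"

definition neighbours :: "'a ugraph \<Rightarrow> 'a \<Rightarrow> 'a set" where
  "neighbours G v = {u \<in> verts G. {u, v} \<in> edges G}"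

definition degree :: "'a ugraph \<Rightarrow> 'a \<Rightarrow> nat" where
  "degree G v = card (neighbours G v)"

definition pendant :: "'a ugraph \<Rightarrow> 'a \<Rightarrow> bool" where
  "pendant G v \<longleftrightarrow> v \<in> verts G \<and> degree G v = 1"

definition interior_vertex :: "'a ugraph \<Rightarrow> 'a \<Rightarrow> bool" where
  "interior_vertex G v \<longleftrightarrow> v \<in> verts G \<and> degree G v > 1"

definition delete_vertex :: "'a ugraph \<Rightarrow> 'a \<Rightarrow> 'a ugraph" where
  "delete_vertex G v = \<lparr>verts = verts G - {v}, edges = {e \<in> edges G. v \<notin> e}\<rparr>"

text \<open>A path is the list of its vertices; \<open>[u]\<close> is the path from \<open>u\<close> to itself.\<close>

definition graph_path :: "'a ugraph \<Rightarrow> 'a list \<Rightarrow> bool" where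
  "graph_path G p \<longleftrightarrow> p \<noteq> [] \<and> set p \<subseteq> verts G \<and> distinct p \<and>
     successively (\<lambda>x y. {x, y} \<in> edges G) p"

definition path_joining :: "'a ugraph \<Rightarrow> 'a \<Rightarrow> 'a list \<Rightarrow> 'a \<Rightarrow> bool" where
  "path_joining G u p v \<longleftrightarrow> graph_path G p \<and> hd p = u \<and> last p = v"

definition graph_cycle :: "'a ugraph \<Rightarrow> 'a list \<Rightarrow> bool" where
  "graph_cycle G c \<longleftrightarrow> graph_path G c \<and> length c \<ge> 3 \<and> {last c, hd c} \<in> edges G"

definition connected_graph :: "'a ugraph \<Rightarrow> bool" where
  "connected_graph G \<longleftrightarrow> verts G \<noteq> {} \<and>
     (\<forall>u \<in> verts G. \<forall>v \<in> verts G. \<exists>p. path_joining G u p v)"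

definition tree :: "'a ugraph \<Rightarrow> bool" where
  "tree G \<longleftrightarrow> simple_graph G \<and> connected_graph G \<and> (\<nexists>c. graph_cycle G c)"

section \<open>Matrices and graphs\<close>

text \<open>Matrix indices start at 0, so the vertex \<open>v\<^sub>i\<close> (\<open>1 \<le> i \<le> m\<close>) is the number \<open>i - 1\<close> and a graph
  on \<open>v\<^sub>1, \<dots>, v\<^sub>m\<close> has vertex set \<open>{0..<m}\<close>.\<close>

definition treeangle :: "nat ugraph \<Rightarrow> real mat \<Rightarrow> bool" where
  "treeangle \<Gamma> A \<longleftrightarrow>
     (\<forall>i \<in> verts \<Gamma>. \<forall>j \<in> verts \<Gamma>. \<forall>k \<in> verts \<Gamma>.
        (\<exists>p. path_joining \<Gamma> i p j \<and> k \<in> set p) \<longrightarrow>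
        A $$ (i, j) * A $$ (k, k) = A $$ (i, k) * A $$ (k, j))"

definition matrix_graph :: "real mat \<Rightarrow> nat ugraph" where
  "matrix_graph C =
     \<lparr>verts = {0..<dim_row C},
      edges = {{i, j} | i j. i < dim_row C \<and> j < dim_row C \<and> i \<noteq> j \<and>
                 (C $$ (i, j) \<noteq> 0 \<or> C $$ (j, i) \<noteq> 0)}\<rparr>"

definition is_moore_penrose :: "real mat \<Rightarrow> real mat \<Rightarrow> bool" where
  "is_moore_penrose A X \<longleftrightarrow> X \<in> carrier_mat (dim_col A) (dim_row A) \<and>
     A * X * A = A \<and> X * A * X = X \<and>
     transpose_mat (A * X) = A * X \<and> transpose_mat (X * A) = X * A"

definition moore_penrose :: "real mat \<Rightarrow> real mat" where
  "moore_penrose A = (THE X. is_moore_penrose A X)"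

lemma is_moore_penrose_unique:
  assumes "is_moore_penrose A X" "is_moore_penrose A Y"
  shows "X = Y"
proof -
  define m n where "m = dim_row A" and "n = dim_col A"
  have A [simp]: "A \<in> carrier_mat m n" by (simp add: m_def n_def)
  have X: "X \<in> carrier_mat n m" "A * X * A = A" "X * A * X = X"
      "transpose_mat (A * X) = A * X" "transpose_mat (X * A) = X * A"
    and Y: "Y \<in> carrier_mat n m" "A * Y * A = A" "Y * A * Y = Y"
      "transpose_mat (A * Y) = A * Y" "transpose_mat (Y * A) = Y * A"
    using assms by (auto simp: is_moore_penrose_def m_def n_def)
  note [simp] = X(1) Y(1)
  have c: "A * X \<in> carrier_mat m m" "A * Y \<in> carrier_mat m m"
      "X * A \<in> carrier_mat n n" "Y * A \<in> carrier_mat n n"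
    by (auto intro!: mult_carrier_mat[OF A X(1)] mult_carrier_mat[OF A Y(1)]
        mult_carrier_mat[OF X(1) A] mult_carrier_mat[OF Y(1) A])
  have l: "A * Y * (A * X) = A * X" "A * X * (A * Y) = A * Y"
    using assoc_mult_mat[OF c(2) A X(1)] assoc_mult_mat[OF c(1) A Y(1)] X(2) Y(2) by simp_all
  have AX: "A * X = A * Y"
    using transpose_mult[OF c(2) c(1)] l X(4) Y(4) by metis
  have r: "X * A * (Y * A) = X * A" "Y * A * (X * A) = Y * A"
    using assoc_mult_mat[OF X(1) A c(4)] assoc_mult_mat[OF Y(1) A c(3)]
      assoc_mult_mat[OF A X(1) A] assoc_mult_mat[OF A Y(1) A] X(2) Y(2) by simp_all
  have XA: "X * A = Y * A"
    using transpose_mult[OF c(3) c(4)] r X(5) Y(5) by metis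
  have "X = X * (A * X)" using X(3) assoc_mult_mat[OF X(1) A X(1)] by simp
  also have "\<dots> = X * A * Y" using AX assoc_mult_mat[OF X(1) A Y(1)] by simp
  also have "\<dots> = Y" using XA Y(3) by simp
  finally show ?thesis .
qed

end

theory Submission
  imports Defs
begin

text \<open>Let \<open>T\<close> be the tree without the pendant vertex \<open>n\<close>, and let \<open>\<alpha> = a\<^sub>r\<^sub>n / a\<^sub>r\<^sub>r\<close> and
  \<open>\<beta> = a\<^sub>n\<^sub>r / a\<^sub>r\<^sub>r\<close>.

  The block \<open>B\<close> is a treeangle matrix for \<open>T\<close>. If \<open>d\<^sub>i\<^sub>j\<close> vanished at an edge of \<open>T\<close>, the treeangle
  identities would make rows \<open>i\<close> and \<open>j\<close> of \<open>B\<close> dependent, or its columns \<open>i\<close> and \<open>j\<close>, against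
  the invertibility of \<open>B\<close> (\<open>edge_minor_nonzero\<close>). With all \<open>d\<^sub>i\<^sub>j\<close> nonzero there is an explicit
  matrix \<open>C\<close> with \<open>B C = 1\<close> (\<open>mult_tree_inverse\<close>): its entry at an edge is \<open>- b\<^sub>i\<^sub>j / d\<^sub>i\<^sub>j\<close>, its
  entries at distinct nonadjacent vertices are zero, and \<open>c\<^sub>r\<^sub>r\<close> is exactly the number \<open>s\<close>. So the
  graph of \<open>C = B\<^sup>-\<^sup>1\<close> is \<open>T\<close>.

  Since every path to \<open>n\<close> passes through \<open>r\<close>, the last column of \<open>A\<close> is \<open>\<alpha>\<close> times column \<open>r\<close> and
  the last row is \<open>\<beta>\<close> times row \<open>r\<close>; for the corner entry this is where singularity is used
  (\<open>singular_corner\<close>). Hence \<open>A = L\<^sub>\<beta> B L\<^sub>\<alpha>\<^sup>T\<close>, where \<open>L\<^sub>\<gamma>\<close> is the identity matrix with the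
  additional row \<open>\<gamma> e\<^sub>r\<close>. This is a full rank factorisation, so \<open>A\<^sup>\<dagger>\<close> is the product of \<open>C\<close> with
  the Moore-Penrose inverses of the outer factors (\<open>moore_penrose_bordered\<close>). Those inverses only
  rescale and duplicate: the entry of \<open>A\<^sup>\<dagger>\<close> at \<open>(i, j)\<close> is a multiple of the entry of \<open>C\<close> at the
  position where \<open>n\<close> is replaced by \<open>r\<close>, and the factor is zero only if \<open>i = n\<close> and \<open>\<alpha> = 0\<close>, or
  \<open>j = n\<close> and \<open>\<beta> = 0\<close>. Therefore \<open>A\<^sup>\<dagger>\<close> has the graph \<open>T\<close> on the old vertices; \<open>{r, n}\<close> is an
  edge iff \<open>s \<noteq> 0\<close>; and \<open>n\<close> is joined to a neighbour \<open>j\<close> of \<open>r\<close> in \<open>T\<close> iff \<open>\<beta> \<noteq> 0\<close> and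
  \<open>a\<^sub>j\<^sub>r \<noteq> 0\<close>, or \<open>\<alpha> \<noteq> 0\<close> and \<open>a\<^sub>r\<^sub>j \<noteq> 0\<close>, which is the definition of \<open>H\<close>.\<close>

section \<open>Paths in trees\<close>

lemma simple_edgeD:
  assumes "simple_graph G" "{u, v} \<in> edges G"
  shows "u \<in> verts G" "v \<in> verts G" "u \<noteq> v"
  using assms by (auto simp: simple_graph_def doubleton_eq_iff)

lemma mem_neighbours_iff:
  assumes "simple_graph G"
  shows "u \<in> neighbours G v \<longleftrightarrow> {u, v} \<in> edges G"
  using simple_edgeD[OF assms] by (auto simp: neighbours_def)

lemma mem_neighbours_commute:
  assumes "simple_graph G"
  shows "u \<in> neighbours G v \<longleftrightarrow> v \<in> neighbours G u"
  by (simp add: mem_neighbours_iff[OF assms] insert_commute)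

lemma finite_neighbours: "simple_graph G \<Longrightarrow> finite (neighbours G v)"
  by (simp add: simple_graph_def neighbours_def)

lemma path_joining_rev: "path_joining G u p v \<Longrightarrow> path_joining G v (rev p) u"
  by (auto simp: path_joining_def graph_path_def hd_rev last_rev insert_commute)

lemma connected_graphE:
  assumes "connected_graph G" "u \<in> verts G" "v \<in> verts G"
  obtains p where "path_joining G u p v"
  using assms by (auto simp: connected_graph_def)

lemma path_joining_snocE:
  assumes "path_joining G u p v" "u \<noteq> v"
  obtains q where "p = q @ [v]" "q \<noteq> []" "{last q, v} \<in> edges G"
proof (cases p rule: rev_cases)
  case Nil
  with assms show ?thesis by (simp add: path_joining_def graph_path_def)
next
  case (snoc q w)
  moreover have "q \<noteq> []" using assms snoc by (auto simp: path_joining_def)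
  ultimately show ?thesis
    using assms that[of q] by (auto simp: path_joining_def graph_path_def successively_append_iff)
qed

text \<open>An inner vertex of a path has its predecessor and its successor as distinct neighbours.\<close>

lemma path_avoids_vertex_of_degree_one:
  assumes "simple_graph G" "path_joining G u p v" "degree G w = 1" "w \<noteq> u" "w \<noteq> v"
  shows "w \<notin> set p"
proof
  assume "w \<in> set p"
  then obtain xs ys where p: "p = xs @ w # ys" by (meson split_list)
  have "xs \<noteq> []" "ys \<noteq> []"
    using assms(2,4,5) p by (auto simp: path_joining_def)
  then have "last xs \<in> set xs" "hd ys \<in> set ys" by simp_all
  moreover have "set xs \<inter> set ys = {}"
    using assms(2) unfolding p by (auto simp: path_joining_def graph_path_def)
  moreover have "{last xs, w} \<in> edges G" "{w, hd ys} \<in> edges G"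
    using assms(2) \<open>xs \<noteq> []\<close> \<open>ys \<noteq> []\<close> unfolding p
    by (auto simp: path_joining_def graph_path_def successively_append_iff successively_Cons)
  ultimately have "{last xs, hd ys} \<subseteq> neighbours G w" "last xs \<noteq> hd ys"
    using mem_neighbours_iff[OF assms(1)] by (auto simp: insert_commute)
  then show False
    using assms(3) finite_neighbours[OF assms(1)] card_mono[of "neighbours G w" "{last xs, hd ys}"]
    by (auto simp: degree_def)
qed

text \<open>If a path from \<open>i\<close> to \<open>k\<close> avoids the neighbour \<open>j\<close> of \<open>i\<close>, then putting \<open>j\<close> in front of it
  gives a path.\<close>

lemma edge_separates:
  assumes "simple_graph G" "connected_graph G" "{i, j} \<in> edges G" "k \<in> verts G"
  obtains p where "path_joining G i p k" "j \<in> set p"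
  | p where "path_joining G j p k" "i \<in> set p"
proof -
  note ij = simple_edgeD[OF assms(1,3)]
  obtain p where p: "path_joining G i p k"
    using connected_graphE assms(2,4) ij(1) by metis
  show thesis
  proof (cases "j \<in> set p")
    case True
    then show ?thesis using that(1) p by blast
  next
    case False
    have "hd p = i" "p \<noteq> []" using p by (auto simp: path_joining_def graph_path_def)
    with False p ij assms(3) have "path_joining G j (j # p) k"
      by (auto simp: path_joining_def graph_path_def successively_Cons insert_commute)
    moreover have "i \<in> set (j # p)" using \<open>hd p = i\<close> \<open>p \<noteq> []\<close> hd_in_set by force
    ultimately show ?thesis using that(2) by blast
  qed
qed

text \<open>Of the branches of a tree at \<open>j\<close>, exactly one contains \<open>i\<close>; \<open>l\<close> is its root. For another
  neighbour \<open>k\<close> of \<open>j\<close>, the path from \<open>i\<close> to \<open>j\<close> extends to \<open>k\<close>, since a path already meeting \<open>k\<close>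
  would close a cycle with the edge from \<open>j\<close> to \<open>k\<close>.\<close>

lemma tree_branch_at:
  assumes "tree G" "i \<in> verts G" "j \<in> verts G" "i \<noteq> j"
  obtains l where "l \<in> neighbours G j" "\<exists>p. path_joining G i p j \<and> l \<in> set p"
    "\<And>k. k \<in> neighbours G j \<Longrightarrow> k \<noteq> l \<Longrightarrow> \<exists>p. path_joining G i p k \<and> j \<in> set p"
proof -
  have G: "simple_graph G" "connected_graph G" and acyclic: "\<nexists>c. graph_cycle G c"
    using assms(1) by (auto simp: tree_def)
  note nbr = mem_neighbours_iff[OF G(1)]
  obtain p where p: "path_joining G i p j"
    using connected_graphE[OF G(2) assms(2,3)] .
  then obtain q where q: "p = q @ [j]" "q \<noteq> []" and edge: "{last q, j} \<in> edges G"
    using assms(4) by (rule path_joining_snocE)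
  show thesis
  proof (rule that[of "last q"])
    show "last q \<in> neighbours G j" using edge nbr by simp
    show "\<exists>p. path_joining G i p j \<and> last q \<in> set p" using p q by auto
    fix k assume k: "k \<in> neighbours G j" "k \<noteq> last q"
    then have kj: "{k, j} \<in> edges G" using nbr by simp
    have "k \<notin> set q"
    proof
      assume "k \<in> set q"
      then obtain xs ys where q': "q = xs @ k # ys" by (meson split_list)
      with k have "ys \<noteq> []" by auto
      then have "graph_cycle G (k # ys @ [j])"
        using p kj unfolding q q'
        by (cases ys) (auto simp: graph_cycle_def path_joining_def graph_path_def
            successively_append_iff successively_Cons insert_commute)
      with acyclic show False by blast
    qed
    then have "path_joining G i (p @ [k]) k"
      using p q kj simple_edgeD[OF G(1) kj]
      by (auto simp: path_joining_def graph_path_def successively_append_iff insert_commute)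
    then show "\<exists>p. path_joining G i p k \<and> j \<in> set p" using q by fastforce
  qed
qed

lemma path_to_pendant_meets_neighbour:
  assumes "simple_graph G" "connected_graph G" "neighbours G v = {r}" "u \<in> verts G" "v \<in> verts G"
    "u \<noteq> v"
  obtains p where "path_joining G u p v" "r \<in> set p"
proof -
  obtain p where p: "path_joining G u p v"
    using connected_graphE[OF assms(2,4,5)] .
  then obtain q where q: "p = q @ [v]" "q \<noteq> []" and "{last q, v} \<in> edges G"
    using assms(6) by (rule path_joining_snocE)
  then have "last q = r" using assms(3) mem_neighbours_iff[OF assms(1)] by blast
  then show thesis using that p q by auto
qed

lemma neighbours_ne_empty:
  assumes "simple_graph G" "connected_graph G" "u \<in> verts G" "v \<in> verts G" "u \<noteq> v"
  shows "neighbours G u \<noteq> {}"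
proof -
  obtain p where "path_joining G v p u"
    using connected_graphE[OF assms(2,4,3)] .
  then obtain q where "{last q, u} \<in> edges G"
    using assms(5) path_joining_snocE by metis
  then show ?thesis using mem_neighbours_iff[OF assms(1)] by auto
qed

text \<open>By the separation property above, an end of the edge is an inner vertex of a
  path to the third vertex.\<close>

lemma edge_has_end_of_degree_ne_one:
  assumes "simple_graph G" "connected_graph G" "{i, j} \<in> edges G" "k \<in> verts G" "k \<noteq> i" "k \<noteq> j"
  shows "degree G i \<noteq> 1 \<or> degree G j \<noteq> 1"
  using edge_separates[OF assms(1-4)]
    path_avoids_vertex_of_degree_one[OF assms(1)] simple_edgeD(3)[OF assms(1,3)] assms(5,6)
  by metis

lemma path_delete_vertexD:
  "path_joining (delete_vertex G v) u p w \<Longrightarrow> path_joining G u p w"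
  by (auto simp: path_joining_def graph_path_def delete_vertex_def intro: successively_mono)

lemma neighbours_delete_vertex:
  "w \<noteq> v \<Longrightarrow> neighbours (delete_vertex G v) w = neighbours G w - {v}"
  by (auto simp: neighbours_def delete_vertex_def)

text \<open>The paths between the remaining vertices avoid the pendant one, so they survive.\<close>

lemma tree_delete_pendant:
  assumes "tree G" "pendant G v" "verts G \<noteq> {v}"
  shows "tree (delete_vertex G v)"
proof -
  have G: "simple_graph G" "connected_graph G" "\<nexists>c. graph_cycle G c"
    using assms(1) by (auto simp: tree_def)
  have deg: "degree G v = 1" using assms(2) by (simp add: pendant_def)
  have "simple_graph (delete_vertex G v)"
    using G(1) by (fastforce simp: simple_graph_def delete_vertex_def)
  moreover have "connected_graph (delete_vertex G v)"
    unfolding connected_graph_def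
  proof (intro conjI ballI)
    show "verts (delete_vertex G v) \<noteq> {}"
      using assms(2,3) by (auto simp: delete_vertex_def pendant_def)
  next
    fix u w assume "u \<in> verts (delete_vertex G v)" "w \<in> verts (delete_vertex G v)"
    then have uw: "u \<in> verts G" "w \<in> verts G" "v \<noteq> u" "v \<noteq> w" by (auto simp: delete_vertex_def)
    then obtain p where p: "path_joining G u p w" using connected_graphE[OF G(2)] by metis
    have "v \<notin> set p" using path_avoids_vertex_of_degree_one[OF G(1) p deg uw(3,4)] .
    then have "path_joining (delete_vertex G v) u p w"
      using p by (auto simp: path_joining_def graph_path_def delete_vertex_def
          elim!: successively_mono)
    then show "\<exists>p. path_joining (delete_vertex G v) u p w" by blast
  qed
  moreover have "graph_cycle G c" if "graph_cycle (delete_vertex G v) c" for c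
    using that path_delete_vertexD[of G v "hd c" c "last c"]
    by (auto simp: graph_cycle_def path_joining_def) (auto simp: delete_vertex_def)
  ultimately show ?thesis using G(3) by (auto simp: tree_def)
qed

section \<open>The inverse of a treeangle matrix\<close>

lemma index_mult_mat_sum:
  assumes "A \<in> carrier_mat n m" "B \<in> carrier_mat m p" "i < n" "j < p"
  shows "(A * B) $$ (i, j) = (\<Sum>k<m. A $$ (i, k) * B $$ (k, j))"
  using assms by (simp add: scalar_prod_def atLeast0LessThan)

lemma treeangleD:
  assumes "treeangle \<Gamma> A" "path_joining \<Gamma> i p j" "k \<in> set p"
  shows "A $$ (i, j) * A $$ (k, k) = A $$ (i, k) * A $$ (k, j)"
proof -
  have "p \<noteq> []" "hd p = i" "last p = j" "set p \<subseteq> verts \<Gamma>"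
    using assms(2) by (auto simp: path_joining_def graph_path_def)
  then have "i \<in> verts \<Gamma>" "j \<in> verts \<Gamma>" "k \<in> verts \<Gamma>"
    using assms(3) hd_in_set[of p] last_in_set[of p] by auto
  then show ?thesis using assms unfolding treeangle_def by blast
qed

lemma treeangle_transpose:
  assumes "treeangle \<Gamma> A" "A \<in> carrier_mat m m" "verts \<Gamma> = {0..<m}"
  shows "treeangle \<Gamma> (transpose_mat A)"
  unfolding treeangle_def
proof (intro ballI impI)
  fix i j k assume v: "i \<in> verts \<Gamma>" "j \<in> verts \<Gamma>" "k \<in> verts \<Gamma>"
    and "\<exists>p. path_joining \<Gamma> i p j \<and> k \<in> set p"
  then obtain p where "path_joining \<Gamma> i p j" "k \<in> set p" by blast
  then have "A $$ (j, i) * A $$ (k, k) = A $$ (j, k) * A $$ (k, i)"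
    using treeangleD[OF assms(1) path_joining_rev] by simp
  then show "transpose_mat A $$ (i, j) * transpose_mat A $$ (k, k) =
      transpose_mat A $$ (i, k) * transpose_mat A $$ (k, j)"
    using v assms(2,3) by (simp add: mult.commute)
qed

definition principal_minor2 :: "real mat \<Rightarrow> nat \<Rightarrow> nat \<Rightarrow> real" where
  "principal_minor2 A i j = A $$ (i, i) * A $$ (j, j) - A $$ (i, j) * A $$ (j, i)"

lemma principal_minor2_commute: "principal_minor2 A i j = principal_minor2 A j i"
  by (simp add: principal_minor2_def)

lemma rows_independent:
  fixes B :: "real mat"
  assumes "B \<in> carrier_mat m m" "C \<in> carrier_mat m m" "B * C = 1\<^sub>m m"
    and "i < m" "j < m" "i \<noteq> j"
    and rows: "\<And>k. k < m \<Longrightarrow> x * B $$ (i, k) = y * B $$ (j, k)"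
  shows "x = 0" "y = 0"
proof -
  have "x * (1\<^sub>m m) $$ (i, l) = y * (1\<^sub>m m) $$ (j, l)" if "l < m" for l
  proof -
    have "(\<Sum>k<m. x * (B $$ (i, k) * C $$ (k, l))) = (\<Sum>k<m. y * (B $$ (j, k) * C $$ (k, l)))"
      using rows by (intro sum.cong) (simp_all flip: mult.assoc)
    then show ?thesis
      using assms(4,5) that unfolding assms(3)[symmetric]
      by (simp add: index_mult_mat_sum[OF assms(1,2)] sum_distrib_left del: index_mult_mat)
  qed
  from this[of i] this[of j] show "x = 0" "y = 0" using assms(4-6) by auto
qed

text \<open>If the \<open>2 \<times> 2\<close> minor at an edge vanishes, the treeangle identities make the two rows
  proportional over the whole matrix: every column index lies beyond one of the two ends.\<close>

lemma rows_proportional: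
  assumes G: "simple_graph \<Gamma>" "connected_graph \<Gamma>" and B: "treeangle \<Gamma> B"
    and e: "{i, j} \<in> edges \<Gamma>" and k: "k \<in> verts \<Gamma>"
    and minor: "principal_minor2 B i j = 0" and nz: "B $$ (i, i) \<noteq> 0"
  shows "B $$ (j, j) * B $$ (i, k) = B $$ (i, j) * B $$ (j, k)"
  using edge_separates[OF G e k]
proof cases
  case (1 p)
  then show ?thesis using treeangleD[OF B 1] by (simp add: mult.commute)
next
  case (2 p)
  have "B $$ (i, i) * (B $$ (j, j) * B $$ (i, k)) = B $$ (i, j) * (B $$ (j, i) * B $$ (i, k))"
    using minor by (simp add: principal_minor2_def)
  also have "\<dots> = B $$ (i, i) * (B $$ (i, j) * B $$ (j, k))"
    using treeangleD[OF B 2] by (simp add: mult_ac)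
  finally show ?thesis using nz by simp
qed

text \<open>With a vanishing minor and \<open>b\<^sub>i\<^sub>i \<noteq> 0\<close>, independence of the proportional rows forces
  \<open>b\<^sub>i\<^sub>j = 0\<close>, and independence of the columns forces \<open>b\<^sub>j\<^sub>i = 0\<close>.\<close>

lemma edge_minor_nonzero:
  assumes G: "simple_graph \<Gamma>" "connected_graph \<Gamma>" "verts \<Gamma> = {0..<m}"
    and B: "treeangle \<Gamma> B" "B \<in> carrier_mat m m"
    and C: "C \<in> carrier_mat m m" "B * C = 1\<^sub>m m"
    and e: "{i, j} \<in> edges \<Gamma>" "B $$ (i, j) \<noteq> 0 \<or> B $$ (j, i) \<noteq> 0"
      "B $$ (i, i) \<noteq> 0 \<or> B $$ (j, j) \<noteq> 0"
  shows "principal_minor2 B i j \<noteq> 0"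
proof
  assume zero: "principal_minor2 B i j = 0"
  have CB: "C * B = 1\<^sub>m m" using mat_mult_left_right_inverse[OF B(2) C] .
  have off_diagonal_zero: "B $$ (k, l) = 0"
    if B: "treeangle \<Gamma> B" "B \<in> carrier_mat m m" and C: "C \<in> carrier_mat m m" "B * C = 1\<^sub>m m"
      and e: "{k, l} \<in> edges \<Gamma>" "principal_minor2 B k l = 0" "B $$ (k, k) \<noteq> 0"
    for B C k l
  proof (rule rows_independent(2)[OF B(2) C])
    show "k < m" "l < m" "k \<noteq> l" using simple_edgeD[OF G(1) e(1)] G(3) by auto
    show "B $$ (l, l) * B $$ (k, h) = B $$ (k, l) * B $$ (l, h)" if "h < m" for h
      using rows_proportional[OF G(1,2) B(1) e(1) _ e(2,3)] that G(3) by simp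
  qed
  have both_zero: "B $$ (k, l) = 0 \<and> B $$ (l, k) = 0"
    if kl: "{k, l} \<in> edges \<Gamma>" "principal_minor2 B k l = 0" "B $$ (k, k) \<noteq> 0" for k l
  proof
    show "B $$ (k, l) = 0" using off_diagonal_zero[OF B C kl] .
    have lt: "k < m" "l < m" using simple_edgeD[OF G(1) kl(1)] G(3) by auto
    have "transpose_mat B * transpose_mat C = 1\<^sub>m m"
      using transpose_mult[OF C(1) B(2)] CB by simp
    moreover have "principal_minor2 (transpose_mat B) k l = 0"
      using kl(2) lt B(2) by (simp add: principal_minor2_def mult.commute)
    ultimately have "transpose_mat B $$ (k, l) = 0"
      using kl(1,3) lt B C
      by (intro off_diagonal_zero[of _ "transpose_mat C"] treeangle_transpose[OF _ _ G(3)]) auto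
    then show "B $$ (l, k) = 0" using lt B(2) by simp
  qed
  show False
    using both_zero[of i j] both_zero[of j i] e zero
    by (auto simp: insert_commute principal_minor2_commute)
qed

text \<open>The inverse of a treeangle matrix lives on the tree. A vertex with zero diagonal entry will
  be an end vertex, so that the sum in its diagonal entry has one term; for an end vertex with
  nonzero diagonal entry both formulas agree.\<close>

definition tree_inverse :: "nat ugraph \<Rightarrow> real mat \<Rightarrow> real mat" where
  "tree_inverse T B = mat (dim_row B) (dim_row B) (\<lambda>(i, j).
     if i = j then
       if B $$ (i, i) \<noteq> 0
       then 1 / B $$ (i, i) *
         (1 + (\<Sum>k\<in>neighbours T i. B $$ (i, k) * B $$ (k, i) / principal_minor2 B i k))
       else (\<Sum>k\<in>neighbours T i. B $$ (k, k) / principal_minor2 B i k)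
     else if {i, j} \<in> edges T then - B $$ (i, j) / principal_minor2 B i j else 0)"

text \<open>Column \<open>j\<close> of the candidate inverse is supported on \<open>j\<close> and its neighbours, so an entry of the
  product is a sum over the star of \<open>j\<close>.\<close>

lemma index_mult_tree_inverse:
  assumes T: "simple_graph T" "verts T = {0..<m}" and B: "B \<in> carrier_mat m m"
    and ij: "i < m" "j < m"
  shows "(B * tree_inverse T B) $$ (i, j) = B $$ (i, j) * tree_inverse T B $$ (j, j) -
    (\<Sum>k\<in>neighbours T j. B $$ (i, k) * B $$ (k, j) / principal_minor2 B j k)"
proof -
  let ?C = "tree_inverse T B" and ?N = "neighbours T j"
  have "j \<notin> ?N" using simple_edgeD(3)[OF T(1), of j j] mem_neighbours_iff[OF T(1)] by auto
  moreover have "?N \<subseteq> {..<m}" using T(2) by (auto simp: neighbours_def)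
  ultimately have N: "finite ?N" "?N \<subseteq> {..<m}" "j \<notin> ?N"
    using finite_neighbours[OF T(1)] by auto
  have C: "?C \<in> carrier_mat m m" using B by (simp add: tree_inverse_def)
  have off: "?C $$ (k, j) =
      (if k \<in> ?N then - B $$ (k, j) / principal_minor2 B j k else 0)" if "k < m" "k \<noteq> j" for k
    using that ij B
    by (auto simp: tree_inverse_def mem_neighbours_iff[OF T(1)] principal_minor2_commute)
  have "(B * ?C) $$ (i, j) = (\<Sum>k<m. B $$ (i, k) * ?C $$ (k, j))"
    by (rule index_mult_mat_sum[OF B C ij])
  also have "\<dots> = (\<Sum>k\<in>insert j ?N. B $$ (i, k) * ?C $$ (k, j))"
    using N ij(2) by (intro sum.mono_neutral_right) (auto simp: off)
  also have "\<dots> = B $$ (i, j) * ?C $$ (j, j) + (\<Sum>k\<in>?N. B $$ (i, k) * ?C $$ (k, j))"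
    using N by simp
  also have "(\<Sum>k\<in>?N. B $$ (i, k) * ?C $$ (k, j)) =
      (\<Sum>k\<in>?N. - (B $$ (i, k) * B $$ (k, j) / principal_minor2 B j k))"
    using N by (intro sum.cong refl) (subst off, auto)
  finally show ?thesis by (simp add: sum_negf)
qed

text \<open>For \<open>i \<noteq> j\<close> the treeangle identities turn every term of the sum over the star of \<open>j\<close> into a
  multiple of \<open>b\<^sub>i\<^sub>j\<close>. The neighbour \<open>l\<close> of \<open>j\<close> on the way to \<open>i\<close> contributes
  \<open>b\<^sub>l\<^sub>l / d\<^sub>j\<^sub>l\<close>, every other neighbour \<open>k\<close> contributes \<open>b\<^sub>j\<^sub>k b\<^sub>k\<^sub>j / (b\<^sub>j\<^sub>j d\<^sub>j\<^sub>k)\<close>, and the total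
  is the diagonal entry of the inverse.\<close>

lemma mult_tree_inverse:
  assumes T: "tree T" "verts T = {0..<m}"
    and B: "treeangle T B" "B \<in> carrier_mat m m"
    and minor: "\<And>i j. {i, j} \<in> edges T \<Longrightarrow> principal_minor2 B i j \<noteq> 0"
    and zero_diagonal: "\<And>i. i < m \<Longrightarrow> B $$ (i, i) = 0 \<Longrightarrow> \<exists>k. neighbours T i = {k}"
  shows "B * tree_inverse T B = 1\<^sub>m m"
proof (rule eq_matI)
  let ?C = "tree_inverse T B" and ?d = "principal_minor2 B"
  have G: "simple_graph T" using T(1) by (simp add: tree_def)
  note fin = finite_neighbours[OF G]
  fix i j assume "i < dim_row (1\<^sub>m m :: real mat)" "j < dim_col (1\<^sub>m m :: real mat)"
  then have ij: "i < m" "j < m" and v: "i \<in> verts T" "j \<in> verts T" using T(2) by simp_all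
  have minor_j: "?d j k \<noteq> 0" if "k \<in> neighbours T j" for k
    using minor[of j k] that by (simp add: mem_neighbours_iff[OF G] insert_commute)
  have entry: "(B * ?C) $$ (i, j) = B $$ (i, j) * ?C $$ (j, j) -
      (\<Sum>k\<in>neighbours T j. B $$ (i, k) * B $$ (k, j) / ?d j k)"
    by (rule index_mult_tree_inverse[OF G T(2) B(2) ij])
  show "(B * ?C) $$ (i, j) = 1\<^sub>m m $$ (i, j)"
  proof (cases "B $$ (j, j) = 0")
    case zero: True
    then obtain l where l: "neighbours T j = {l}" using zero_diagonal ij by blast
    have Cjj: "?C $$ (j, j) = B $$ (l, l) / ?d j l"
      using ij B(2) zero l by (simp add: tree_inverse_def)
    have dl: "?d j l \<noteq> 0" using minor_j l by simp
    show ?thesis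
    proof (cases "i = j")
      case True
      have "?d j l = - (B $$ (j, l) * B $$ (l, j))" using zero by (simp add: principal_minor2_def)
      then show ?thesis using entry True zero l ij dl by (auto simp del: index_mult_mat)
    next
      case False
      then obtain h p where "h \<in> neighbours T j" "path_joining T i p j" "h \<in> set p"
        using tree_branch_at[OF T(1) v] by metis
      then have "B $$ (i, j) * B $$ (l, l) = B $$ (i, l) * B $$ (l, j)"
        using treeangleD[OF B(1), of i p j h] l by simp
      then show ?thesis using entry False l Cjj ij by (simp del: index_mult_mat)
    qed
  next
    case nz: False
    let ?S = "\<Sum>k\<in>neighbours T j. B $$ (j, k) * B $$ (k, j) / ?d j k"
    have Cjj: "?C $$ (j, j) = 1 / B $$ (j, j) * (1 + ?S)"
      using ij B(2) nz by (simp add: tree_inverse_def)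
    show ?thesis
    proof (cases "i = j")
      case True
      then show ?thesis using entry Cjj nz ij by (simp del: index_mult_mat)
    next
      case False
      then obtain l where l: "l \<in> neighbours T j" "\<exists>p. path_joining T i p j \<and> l \<in> set p"
        "\<And>k. k \<in> neighbours T j \<Longrightarrow> k \<noteq> l \<Longrightarrow> \<exists>p. path_joining T i p k \<and> j \<in> set p"
        using tree_branch_at[OF T(1) v] by metis
      let ?M = "neighbours T j - {l}" and ?t = "\<lambda>k. B $$ (j, k) * B $$ (k, j) / ?d j k"
      have near: "B $$ (i, l) * B $$ (l, j) = B $$ (i, j) * B $$ (l, l)"
        using l(2) treeangleD[OF B(1)] by metis
      have far: "B $$ (i, k) * B $$ (k, j) / ?d j k = B $$ (i, j) / B $$ (j, j) * ?t k"
        if "k \<in> ?M" for k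
      proof -
        have "B $$ (i, k) * B $$ (j, j) = B $$ (i, j) * B $$ (j, k)"
          using l(3) that treeangleD[OF B(1)] by (metis Diff_iff singletonI)
        then have "B $$ (i, k) = B $$ (i, j) * B $$ (j, k) / B $$ (j, j)"
          using nz by (simp add: field_simps)
        then show ?thesis by simp
      qed
      have "(\<Sum>k\<in>neighbours T j. B $$ (i, k) * B $$ (k, j) / ?d j k) =
          B $$ (i, j) * B $$ (l, l) / ?d j l + B $$ (i, j) / B $$ (j, j) * sum ?t ?M"
        using far by (simp add: sum.remove[OF fin l(1)] near sum_distrib_left)
      moreover have "?S = ?t l + sum ?t ?M" by (rule sum.remove[OF fin l(1)])
      ultimately have "(B * ?C) $$ (i, j) =
          B $$ (i, j) * (1 / B $$ (j, j) * (1 + ?t l) - B $$ (l, l) / ?d j l)"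
        unfolding entry Cjj by (simp add: algebra_simps add_divide_distrib)
      also have "1 / B $$ (j, j) * (1 + ?t l) = B $$ (l, l) / ?d j l"
      proof -
        have "1 + ?t l = (?d j l + B $$ (j, l) * B $$ (l, j)) / ?d j l"
          using minor_j[OF l(1)] by (simp add: add_divide_distrib)
        also have "?d j l + B $$ (j, l) * B $$ (l, j) = B $$ (j, j) * B $$ (l, l)"
          by (simp add: principal_minor2_def)
        finally show ?thesis using nz by simp
      qed
      finally show ?thesis using False ij by (simp del: index_mult_mat)
    qed
  qed
qed (use B in \<open>simp_all add: tree_inverse_def\<close>)

section \<open>The Moore-Penrose inverse of a bordered matrix\<close>

lemma moore_penrose_eqI: "is_moore_penrose A X \<Longrightarrow> moore_penrose A = X"
  unfolding moore_penrose_def using is_moore_penrose_unique by blast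

text \<open>The inverses cancel in the middle of both products: \<open>A A\<^sup>\<dagger> = L L'\<close> and \<open>A\<^sup>\<dagger> A = R' R\<close>.\<close>

lemma is_moore_penrose_factorisation:
  assumes L: "L \<in> carrier_mat p n" "L' \<in> carrier_mat n p" "L' * L = 1\<^sub>m n"
      "transpose_mat (L * L') = L * L'"
    and R: "R \<in> carrier_mat n p" "R' \<in> carrier_mat p n" "R * R' = 1\<^sub>m n"
      "transpose_mat (R' * R) = R' * R"
    and B: "B \<in> carrier_mat n n" "C \<in> carrier_mat n n" "B * C = 1\<^sub>m n" "C * B = 1\<^sub>m n"
  shows "is_moore_penrose (L * B * R) (R' * C * L')"
proof -
  note c [simp] = L(1,2) R(1,2) B(1,2)
  note a = assoc_mult_mat
  have R1: "R * (R' * Z) = Z" if "Z \<in> carrier_mat n p" for Z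
    using a[OF R(1,2) that] R(3) that by simp
  have B1: "B * (C * Z) = Z" if "Z \<in> carrier_mat n p" for Z
    using a[OF B(1,2) that] B(3) that by simp
  have L1: "L' * (L * Z) = Z" if "Z \<in> carrier_mat n p" for Z
    using a[OF L(2,1) that] L(3) that by simp
  have C1: "C * (B * Z) = Z" if "Z \<in> carrier_mat n p" for Z
    using a[OF B(2,1) that] B(4) that by simp
  have A: "L * B * R = L * (B * R)" by (rule a[OF L(1) B(1) R(1)])
  have X: "R' * C * L' = R' * (C * L')" by (rule a[OF R(2) B(2) L(2)])
  have BR: "B * R \<in> carrier_mat n p" and CL: "C * L' \<in> carrier_mat n p"
    using mult_carrier_mat c by blast+
  have AX: "(L * B * R) * (R' * C * L') = L * L'"
    unfolding A X using BR CL
    by (simp add: a[OF L(1) BR mult_carrier_mat[OF R(2) CL]]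
        a[OF B(1) R(1) mult_carrier_mat[OF R(2) CL]] R1 B1 del: assoc_mult_mat)
  have XA: "(R' * C * L') * (L * B * R) = R' * R"
    unfolding A X using BR CL
    by (simp add: a[OF R(2) CL mult_carrier_mat[OF L(1) BR]]
        a[OF B(2) L(2) mult_carrier_mat[OF L(1) BR]] L1 C1 del: assoc_mult_mat)
  have "(L * L') * (L * (B * R)) = L * (B * R)"
    using BR by (simp add: a[OF L(1,2) mult_carrier_mat[OF L(1) BR]] L1 del: assoc_mult_mat)
  moreover have "(R' * R) * (R' * (C * L')) = R' * (C * L')"
    using CL by (simp add: a[OF R(2,1) mult_carrier_mat[OF R(2) CL]] R1 del: assoc_mult_mat)
  ultimately show ?thesis
    unfolding is_moore_penrose_def AX XA unfolding A X
    using L(4) R(4) mult_carrier_mat[OF R(2) CL] carrier_matD(1)[OF L(1)] carrier_matD(2)[OF R(1)]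
    by (simp del: assoc_mult_mat)
qed

definition weighted_selection :: "nat \<Rightarrow> nat \<Rightarrow> (nat \<Rightarrow> nat) \<Rightarrow> (nat \<Rightarrow> real) \<Rightarrow> real mat" where
  "weighted_selection p n f w = mat p n (\<lambda>(i, j). if j = f i then w i else 0)"

lemma weighted_selection_carrier [simp]: "weighted_selection p n f w \<in> carrier_mat p n"
  by (simp add: weighted_selection_def)

lemma index_weighted_selection_sandwich:
  assumes "M \<in> carrier_mat n n" "\<And>i. i < p \<Longrightarrow> f i < n" "i < p" "j < p"
  shows "(weighted_selection p n f u * M * transpose_mat (weighted_selection p n f v)) $$ (i, j) =
    u i * M $$ (f i, f j) * v j"
proof -
  let ?U = "weighted_selection p n f u" and ?V = "weighted_selection p n f v"
  have UM: "(?U * M) $$ (i, k) = u i * M $$ (f i, k)" if "k < n" for k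
  proof -
    have "(?U * M) $$ (i, k) = (\<Sum>l<n. (if l = f i then u i * M $$ (l, k) else 0))"
      unfolding index_mult_mat_sum[OF weighted_selection_carrier assms(1,3) that]
      using assms(3) by (intro sum.cong) (auto simp: weighted_selection_def)
    then show ?thesis using assms(2)[OF assms(3)] by simp
  qed
  have V: "transpose_mat ?V $$ (k, j) = (if k = f j then v j else 0)" if "k < n" for k
    using that assms(4) by (simp add: weighted_selection_def)
  have "(?U * M * transpose_mat ?V) $$ (i, j) =
      (\<Sum>k<n. (?U * M) $$ (i, k) * transpose_mat ?V $$ (k, j))"
    by (rule index_mult_mat_sum[OF mult_carrier_mat[OF weighted_selection_carrier assms(1)]
          _ assms(3,4)]) simp
  also have "\<dots> = (\<Sum>k<n. (if k = f j then u i * M $$ (f i, k) * v j else 0))"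
    by (intro sum.cong) (simp_all add: UM V del: index_mult_mat)
  finally show ?thesis using assms(2)[OF assms(4)] by simp
qed

text \<open>For the matrix \<open>L\<close> whose rows are the unit vectors \<open>e\<^sub>0, \<dots>, e\<^sub>n\<^sub>-\<^sub>1\<close> followed by
  \<open>\<gamma> e\<^sub>r\<close>, these are the index and the coefficient of each row.\<close>

definition border_index :: "nat \<Rightarrow> nat \<Rightarrow> nat \<Rightarrow> nat" where
  "border_index n r i = (if i = n then r else i)"

definition border_coeff :: "nat \<Rightarrow> real \<Rightarrow> nat \<Rightarrow> real" where
  "border_coeff n \<gamma> i = (if i = n then \<gamma> else 1)"

text \<open>As \<open>L\<^sup>T L\<close> is the identity plus \<open>\<gamma>\<^sup>2\<close> at position \<open>(r, r)\<close>, the Moore-Penrose inverse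
  \<open>(L\<^sup>T L)\<^sup>-\<^sup>1 L\<^sup>T\<close> of \<open>L\<close> is \<open>L\<^sup>T\<close> with these coefficients instead.\<close>

definition border_pinv_coeff :: "nat \<Rightarrow> nat \<Rightarrow> real \<Rightarrow> nat \<Rightarrow> real" where
  "border_pinv_coeff n r \<gamma> i =
     (if i = n then \<gamma> / (1 + \<gamma>\<^sup>2) else if i = r then 1 / (1 + \<gamma>\<^sup>2) else 1)"

lemma one_plus_square_ne_0: "1 + (x :: real)\<^sup>2 \<noteq> 0"
  using zero_le_power2[of x] by linarith

lemma border_pinv_coeff_eq_0_iff:
  "border_pinv_coeff n r \<gamma> i = 0 \<longleftrightarrow> i = n \<and> \<gamma> = 0"
  using one_plus_square_ne_0[of \<gamma>] by (simp add: border_pinv_coeff_def)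

lemma border_index_less: "r < n \<Longrightarrow> i < n + 1 \<Longrightarrow> border_index n r i < n"
  by (simp add: border_index_def)

lemma border_left_inverse:
  assumes "r < n"
  shows "transpose_mat (weighted_selection (n + 1) n (border_index n r) (border_pinv_coeff n r \<gamma>)) *
    weighted_selection (n + 1) n (border_index n r) (border_coeff n \<gamma>) = 1\<^sub>m n"
    (is "transpose_mat ?W * ?L = _")
proof (rule eq_matI)
  fix i j assume "i < dim_row (1\<^sub>m n :: real mat)" "j < dim_col (1\<^sub>m n :: real mat)"
  then have ij: "i < n" "j < n" by simp_all
  have Wt: "transpose_mat ?W \<in> carrier_mat n (n + 1)" by simp
  let ?t = "\<lambda>k. transpose_mat ?W $$ (i, k) * ?L $$ (k, j)"
  have "(transpose_mat ?W * ?L) $$ (i, j) = sum ?t {..<n + 1}"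
    by (rule index_mult_mat_sum[OF Wt weighted_selection_carrier ij])
  also have "\<dots> = sum ?t {..<n} + ?t n" by simp
  also have "sum ?t {..<n} =
      (\<Sum>k<n. if k = i then (if i = j then border_pinv_coeff n r \<gamma> i else 0) else 0)"
    using ij by (intro sum.cong)
      (auto simp: weighted_selection_def border_index_def border_coeff_def)
  also have "\<dots> = (if i = j then border_pinv_coeff n r \<gamma> i else 0)" using ij by simp
  also have "?t n = (if i = r \<and> j = r then \<gamma>\<^sup>2 / (1 + \<gamma>\<^sup>2) else 0)"
    using ij by (simp add: weighted_selection_def border_index_def border_coeff_def
        border_pinv_coeff_def power2_eq_square)
  also have "(if i = j then border_pinv_coeff n r \<gamma> i else 0) + \<dots> = 1\<^sub>m n $$ (i, j)"
    using ij one_plus_square_ne_0[of \<gamma>]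
    by (simp add: border_pinv_coeff_def flip: add_divide_distrib)
  finally show "(transpose_mat ?W * ?L) $$ (i, j) = 1\<^sub>m n $$ (i, j)" .
qed (simp_all add: weighted_selection_def)

lemma border_projection_symmetric:
  assumes "r < n"
  shows "transpose_mat (weighted_selection (n + 1) n (border_index n r) (border_coeff n \<gamma>) *
      transpose_mat (weighted_selection (n + 1) n (border_index n r) (border_pinv_coeff n r \<gamma>))) =
    weighted_selection (n + 1) n (border_index n r) (border_coeff n \<gamma>) *
      transpose_mat (weighted_selection (n + 1) n (border_index n r) (border_pinv_coeff n r \<gamma>))"
    (is "transpose_mat (?L * transpose_mat ?W) = _")
proof (rule eq_matI)
  have entry: "(?L * transpose_mat ?W) $$ (i, j) = (if border_index n r i = border_index n r j
      then border_coeff n \<gamma> i * border_pinv_coeff n r \<gamma> j else 0)" if "i < n + 1" "j < n + 1" for i j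
    using index_weighted_selection_sandwich[OF one_carrier_mat border_index_less[OF assms] that,
        where u = "border_coeff n \<gamma>" and v = "border_pinv_coeff n r \<gamma>"]
      border_index_less[OF assms that(1)] border_index_less[OF assms that(2)]
    by (simp add: right_mult_one_mat[OF weighted_selection_carrier] del: index_mult_mat)
  fix i j assume "i < dim_row (?L * transpose_mat ?W)" "j < dim_col (?L * transpose_mat ?W)"
  then have ij: "i < n + 1" "j < n + 1" by (simp_all add: weighted_selection_def)
  then have "transpose_mat (?L * transpose_mat ?W) $$ (i, j) = (?L * transpose_mat ?W) $$ (j, i)"
    by (simp add: weighted_selection_def)
  also have "\<dots> = (?L * transpose_mat ?W) $$ (i, j)"
    unfolding entry[OF ij] entry[OF ij(2,1)] using assms
    by (auto simp: border_index_def border_coeff_def border_pinv_coeff_def)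
  finally show "transpose_mat (?L * transpose_mat ?W) $$ (i, j) = (?L * transpose_mat ?W) $$ (i, j)" .
qed (simp_all add: weighted_selection_def)

text \<open>The hypothesis on the entries says that \<open>A\<close> arises from \<open>B\<close> by appending \<open>\<beta>\<close> times row \<open>r\<close>
  and then \<open>\<alpha>\<close> times column \<open>r\<close>, that is, \<open>A = L\<^sub>\<beta> B L\<^sub>\<alpha>\<^sup>T\<close>.\<close>

lemma moore_penrose_bordered:
  assumes r: "r < n" and A: "A \<in> carrier_mat (n + 1) (n + 1)"
    and B: "B \<in> carrier_mat n n" "C \<in> carrier_mat n n" "B * C = 1\<^sub>m n"
    and border: "\<And>i j. i < n + 1 \<Longrightarrow> j < n + 1 \<Longrightarrow> A $$ (i, j) =
      border_coeff n \<beta> i * B $$ (border_index n r i, border_index n r j) * border_coeff n \<alpha> j"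
  shows "moore_penrose A \<in> carrier_mat (n + 1) (n + 1)"
    and "\<And>i j. i < n + 1 \<Longrightarrow> j < n + 1 \<Longrightarrow> moore_penrose A $$ (i, j) =
      border_pinv_coeff n r \<alpha> i * C $$ (border_index n r i, border_index n r j) *
      border_pinv_coeff n r \<beta> j"
proof -
  let ?L = "\<lambda>\<gamma>. weighted_selection (n + 1) n (border_index n r) (border_coeff n \<gamma>)"
  let ?W = "\<lambda>\<gamma>. weighted_selection (n + 1) n (border_index n r) (border_pinv_coeff n r \<gamma>)"
  let ?X = "?W \<alpha> * C * transpose_mat (?W \<beta>)"
  have carriers: "?L \<gamma> \<in> carrier_mat (n + 1) n" "?W \<gamma> \<in> carrier_mat (n + 1) n"
    "transpose_mat (?L \<gamma>) \<in> carrier_mat n (n + 1)" "transpose_mat (?W \<gamma>) \<in> carrier_mat n (n + 1)" for \<gamma>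
    by simp_all
  have CB: "C * B = 1\<^sub>m n" using mat_mult_left_right_inverse[OF B] .
  have "transpose_mat (?L \<alpha>) * ?W \<alpha> = transpose_mat (transpose_mat (?W \<alpha>) * ?L \<alpha>)"
    by (simp only: transpose_mult[OF carriers(4) carriers(1)] transpose_transpose)
  then have right: "transpose_mat (?L \<alpha>) * ?W \<alpha> = 1\<^sub>m n"
    by (simp only: border_left_inverse[OF r] transpose_one)
  have right_sym: "transpose_mat (?W \<alpha> * transpose_mat (?L \<alpha>)) = ?W \<alpha> * transpose_mat (?L \<alpha>)"
    using border_projection_symmetric[OF r, of \<alpha>]
    by (simp only: transpose_mult[OF carriers(1) carriers(4)]
        transpose_mult[OF carriers(2) carriers(3)] transpose_transpose)
  have "A = ?L \<beta> * B * transpose_mat (?L \<alpha>)"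
  proof (rule eq_matI)
    fix i j assume "i < dim_row (?L \<beta> * B * transpose_mat (?L \<alpha>))"
      "j < dim_col (?L \<beta> * B * transpose_mat (?L \<alpha>))"
    then have ij: "i < n + 1" "j < n + 1" by (simp_all add: weighted_selection_def)
    show "A $$ (i, j) = (?L \<beta> * B * transpose_mat (?L \<alpha>)) $$ (i, j)"
      unfolding border[OF ij]
      by (rule index_weighted_selection_sandwich[OF B(1) border_index_less[OF r] ij, symmetric])
  qed (use A in \<open>simp_all add: weighted_selection_def\<close>)
  then have "is_moore_penrose A ?X"
    using is_moore_penrose_factorisation[OF carriers(1,4) border_left_inverse[OF r]
        border_projection_symmetric[OF r] carriers(3,2) right right_sym B CB] by simp
  then have X: "moore_penrose A = ?X" by (rule moore_penrose_eqI)
  show "moore_penrose A \<in> carrier_mat (n + 1) (n + 1)"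
    unfolding X by (rule mult_carrier_mat[OF mult_carrier_mat[OF carriers(2) B(2)] carriers(4)])
  fix i j assume ij: "i < n + 1" "j < n + 1"
  show "moore_penrose A $$ (i, j) =
      border_pinv_coeff n r \<alpha> i * C $$ (border_index n r i, border_index n r j) *
      border_pinv_coeff n r \<beta> j"
    unfolding X by (rule index_weighted_selection_sandwich[OF B(2) border_index_less[OF r] ij])
qed

lemma not_invertible_mat_kernel:
  fixes A :: "real mat"
  assumes "A \<in> carrier_mat n n" "\<not> invertible_mat A"
  obtains v where "v \<in> carrier_vec n" "v \<noteq> 0\<^sub>v n" "A *\<^sub>v v = 0\<^sub>v n"
proof -
  have "det A = 0"
  proof (rule ccontr)
    assume "det A \<noteq> 0"
    then obtain C where "C \<in> carrier_mat n n" "C * A = 1\<^sub>m n" "A * C = 1\<^sub>m n"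
      using det_non_zero_imp_unit[OF assms(1), of "()"] by (auto simp: Units_def ring_mat_def)
    with assms show False by (auto simp: invertible_mat_def inverts_mat_def)
  qed
  then show thesis using that det_0_iff_vec_prod_zero[OF assms(1)] by blast
qed

text \<open>Above the corner the last column is \<open>\<alpha>\<close> times column \<open>r\<close>. Hence a kernel vector \<open>v\<close> is
  a multiple of \<open>e\<^sub>n - \<alpha> e\<^sub>r\<close>, because \<open>B\<close> is injective, and the last row of \<open>A v = 0\<close>
  extends the proportionality to the corner.\<close>

lemma singular_corner:
  fixes A B C :: "real mat"
  assumes r: "r < n" and A: "A \<in> carrier_mat (n + 1) (n + 1)" "\<not> invertible_mat A"
    and B: "B \<in> carrier_mat n n" "C \<in> carrier_mat n n" "C * B = 1\<^sub>m n"
    and AB: "\<And>i j. i < n \<Longrightarrow> j < n \<Longrightarrow> B $$ (i, j) = A $$ (i, j)"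
    and column: "\<And>i. i < n \<Longrightarrow> A $$ (i, n) = \<alpha> * A $$ (i, r)"
  shows "A $$ (n, n) = \<alpha> * A $$ (n, r)"
proof -
  obtain v where v: "v \<in> carrier_vec (n + 1)" "v \<noteq> 0\<^sub>v (n + 1)" "A *\<^sub>v v = 0\<^sub>v (n + 1)"
    using not_invertible_mat_kernel[OF A] .
  have row: "(\<Sum>k<n. A $$ (i, k) * v $ k) + A $$ (i, n) * v $ n = 0" if "i < n + 1" for i
  proof -
    have "(\<Sum>k<n + 1. A $$ (i, k) * v $ k) = (A *\<^sub>v v) $ i"
      using that A(1) v(1) by (simp add: scalar_prod_def atLeast0LessThan)
    then show ?thesis using v(3) that by simp
  qed
  define u where "u = vec n (\<lambda>k. v $ k + (if k = r then \<alpha> * v $ n else 0))"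
  have u: "u \<in> carrier_vec n" by (simp add: u_def)
  have "B *\<^sub>v u = 0\<^sub>v n"
  proof (rule eq_vecI)
    fix i assume "i < dim_vec (0\<^sub>v n :: real vec)"
    then have i: "i < n" by simp
    have "(B *\<^sub>v u) $ i =
        (\<Sum>k<n. A $$ (i, k) * v $ k + (if k = r then A $$ (i, k) * (\<alpha> * v $ n) else 0))"
      using i B(1) by (auto simp: scalar_prod_def atLeast0LessThan u_def AB algebra_simps
          intro!: sum.cong)
    also have "\<dots> = (\<Sum>k<n. A $$ (i, k) * v $ k) + A $$ (i, n) * v $ n"
      using r i by (simp add: sum.distrib column)
    finally show "(B *\<^sub>v u) $ i = 0\<^sub>v n $ i" using row[of i] i by simp
  qed (use B in simp)
  moreover have "C *\<^sub>v 0\<^sub>v n = 0\<^sub>v n"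
    using B(2) by (intro eq_vecI) (auto simp: scalar_prod_def)
  ultimately have "u = 0\<^sub>v n"
    using assoc_mult_mat_vec[OF B(2,1) u] B u by simp
  then have vk: "v $ k = - (if k = r then \<alpha> * v $ n else 0)" if "k < n" for k
  proof -
    have "u $ k = 0" using \<open>u = 0\<^sub>v n\<close> that by simp
    then show ?thesis using that by (auto simp: u_def eq_neg_iff_add_eq_0 split: if_splits)
  qed
  have "v $ n \<noteq> 0"
  proof
    assume "v $ n = 0"
    then have "v = 0\<^sub>v (n + 1)" using v(1) vk by (intro eq_vecI) (auto simp: less_Suc_eq)
    with v(2) show False ..
  qed
  moreover have "(\<Sum>k<n. A $$ (n, k) * v $ k) = - (A $$ (n, r) * (\<alpha> * v $ n))"
  proof -
    have "(\<Sum>k<n. A $$ (n, k) * v $ k) =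
        (\<Sum>k<n. if k = r then - (A $$ (n, r) * (\<alpha> * v $ n)) else 0)"
      by (intro sum.cong) (auto simp: vk)
    then show ?thesis using r by simp
  qed
  ultimately show ?thesis using row[of n] by (simp add: algebra_simps)
qed

section \<open>The graph of the Moore-Penrose inverse\<close>

theorem theorem2p1:
  fixes n r :: nat
    and \<Gamma> :: "nat ugraph"
    and A B :: "real mat"
    and G :: "nat ugraph"
    and N' N'' H :: "nat set set"
    and d :: "nat \<Rightarrow> nat \<Rightarrow> real"
    and s :: real
  assumes n: "n \<ge> 3"
    and tree: "tree \<Gamma>"
    and verts: "verts \<Gamma> = {0..<n + 1}"
    and pendant: "pendant \<Gamma> n"
    and r: "r \<in> neighbours \<Gamma> n"
    and A: "A \<in> carrier_mat (n + 1) (n + 1)"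
    and singular: "\<not> invertible_mat A"
    and treeangle: "treeangle \<Gamma> A"
    and edge_nonzero: "\<And>i j. {i, j} \<in> edges \<Gamma> \<Longrightarrow> A $$ (i, j) \<noteq> 0 \<or> A $$ (j, i) \<noteq> 0"
    and interior: "\<And>i. interior_vertex \<Gamma> i \<Longrightarrow> A $$ (i, i) \<noteq> 0"
    and B: "B = mat_delete A n n"
    and B_invertible: "invertible_mat B"
    and G: "G = matrix_graph (moore_penrose A)"
    and N': "N' = {{j, n} | j. j \<in> neighbours \<Gamma> r - {n} \<and> A $$ (j, r) \<noteq> 0}"
    and N'': "N'' = {{j, n} | j. j \<in> neighbours \<Gamma> r - {n} \<and> A $$ (r, j) \<noteq> 0}"
    and H_a: "A $$ (r, n) \<noteq> 0 \<and> A $$ (n, r) = 0 \<Longrightarrow> H = N''"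
    and H_b: "A $$ (n, r) \<noteq> 0 \<and> A $$ (r, n) = 0 \<Longrightarrow> H = N'"
    and H_c: "A $$ (r, n) \<noteq> 0 \<and> A $$ (n, r) \<noteq> 0 \<Longrightarrow> H = N' \<union> N''"
    and d: "\<And>i j. d i j = A $$ (i, i) * A $$ (j, j) - A $$ (i, j) * A $$ (j, i)"
    and s: "s = 1 / A $$ (r, r) *
              (1 + (\<Sum>k \<in> neighbours \<Gamma> r - {n}. A $$ (r, k) * A $$ (k, r) / d r k))"
  shows "(\<forall>i j. {i, j} \<in> edges (delete_vertex \<Gamma> n) \<longrightarrow> d i j \<noteq> 0) \<and>
    (s \<noteq> 0 \<longrightarrow> edges G = edges \<Gamma> \<union> H) \<and>
    (s = 0 \<longrightarrow> edges G = (edges \<Gamma> - {{r, n}}) \<union> H)"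
proof -
  let ?T = "delete_vertex \<Gamma> n"
  have G\<Gamma>: "simple_graph \<Gamma>" "connected_graph \<Gamma>" using tree by (auto simp: tree_def)
  note nbr\<Gamma> = mem_neighbours_iff[OF G\<Gamma>(1)]
  have T: "tree ?T"
  proof (rule tree_delete_pendant[OF tree pendant])
    have "0 \<in> verts \<Gamma>" "0 \<noteq> n" using verts n by auto
    then show "verts \<Gamma> \<noteq> {n}" by auto
  qed
  then have GT: "simple_graph ?T" "connected_graph ?T" by (auto simp: tree_def)
  have vT: "verts ?T = {0..<n}" by (simp add: delete_vertex_def verts atLeast0_lessThan_Suc)
  have edgeT: "{i, j} \<in> edges ?T \<longleftrightarrow> {i, j} \<in> edges \<Gamma> \<and> i \<noteq> n \<and> j \<noteq> n" for i j
    by (simp add: delete_vertex_def eq_commute)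
  have edgeT_less: "i < n" "j < n" "i \<noteq> j" if "{i, j} \<in> edges ?T" for i j
    using simple_edgeD[OF GT(1) that] by (simp_all add: vT)
  have nbr_n: "neighbours \<Gamma> n = {r}"
    using pendant r by (auto simp: pendant_def degree_def card_1_singleton_iff)
  have edge_n: "{j, n} \<in> edges \<Gamma> \<longleftrightarrow> j = r" for j using nbr\<Gamma>[of j n] nbr_n by auto
  have rn: "r < n"
    using r simple_edgeD[OF G\<Gamma>(1), of r n] verts by (auto simp: nbr\<Gamma>)
  have nbr_T: "neighbours ?T i = neighbours \<Gamma> i - {n}" if "i < n" for i
    using neighbours_delete_vertex[of i n \<Gamma>] that by simp
  have nbr_ne: "neighbours ?T i \<noteq> {}" if "i < n" for i
  proof -
    define k where "k = (if i = 0 then 1 else 0 :: nat)"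
    have "k < n" "k \<noteq> i" using n by (auto simp: k_def)
    then show ?thesis using neighbours_ne_empty[OF GT, of i k] vT that by auto
  qed

  \<comment> \<open>A vertex with zero diagonal entry is an end vertex of \<open>\<Gamma>\<close>, and it is not \<open>r\<close>, which has a
    neighbour other than \<open>n\<close>.\<close>
  have degree_le: "degree \<Gamma> i \<le> 1" if "i < n" "A $$ (i, i) = 0" for i
    using interior[of i] that verts by (cases "degree \<Gamma> i \<le> 1") (auto simp: interior_vertex_def)
  have arr: "A $$ (r, r) \<noteq> 0"
  proof
    assume "A $$ (r, r) = 0"
    then have "card (neighbours \<Gamma> r) \<le> 1" using degree_le rn by (simp add: degree_def)
    moreover obtain k where "k \<in> neighbours \<Gamma> r" "k \<noteq> n" using nbr_ne[OF rn] nbr_T[OF rn] by auto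
    moreover have "n \<in> neighbours \<Gamma> r" using r mem_neighbours_commute[OF G\<Gamma>(1)] by blast
    ultimately show False
      using card_mono[OF finite_neighbours[OF G\<Gamma>(1)], of "{k, n}" r] by auto
  qed
  have end_T: "\<exists>k. neighbours ?T i = {k}" if "i < n" "A $$ (i, i) = 0" for i
  proof -
    have "card (neighbours ?T i) \<le> card (neighbours \<Gamma> i)"
      using nbr_T[OF that(1)] by (auto intro: card_mono finite_neighbours[OF G\<Gamma>(1)])
    moreover have "card (neighbours ?T i) \<noteq> 0"
      using nbr_ne[OF that(1)] finite_neighbours[OF GT(1)] by simp
    ultimately have "card (neighbours ?T i) = 1"
      using degree_le[OF that] by (simp add: degree_def)
    then show ?thesis by (simp add: card_1_singleton_iff)
  qed
  have diag: "A $$ (i, i) \<noteq> 0 \<or> A $$ (j, j) \<noteq> 0" if e: "{i, j} \<in> edges ?T" for i j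
  proof -
    have "card ({0..<n} - {i, j}) \<noteq> 0"
      using n edgeT_less[OF e] by (subst card_Diff_subset) auto
    then have "{0..<n} - {i, j} \<noteq> {}" by (metis card.empty)
    then obtain k where "k \<in> {0..<n} - {i, j}" by blast
    then have "degree ?T i \<noteq> 1 \<or> degree ?T j \<noteq> 1"
      using edge_has_end_of_degree_ne_one[OF GT e, of k] vT by simp
    then show ?thesis
      using end_T[of i] end_T[of j] edgeT_less[OF e] by (auto simp: degree_def)
  qed

  have Bc: "B \<in> carrier_mat n n" using mat_delete_carrier[OF A] B by simp
  have AB: "B $$ (i, j) = A $$ (i, j)" if "i < n" "j < n" for i j
    using that A unfolding B by (simp add: mat_delete_def)
  have B_treeangle: "treeangle ?T B"
    unfolding treeangle_def
  proof (intro ballI impI)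
    fix i j k assume ijk: "i \<in> verts ?T" "j \<in> verts ?T" "k \<in> verts ?T"
      and "\<exists>p. path_joining ?T i p j \<and> k \<in> set p"
    then obtain p where "path_joining ?T i p j" "k \<in> set p" by blast
    then have "A $$ (i, j) * A $$ (k, k) = A $$ (i, k) * A $$ (k, j)"
      using treeangleD[OF treeangle path_delete_vertexD] by blast
    then show "B $$ (i, j) * B $$ (k, k) = B $$ (i, k) * B $$ (k, j)"
      using ijk vT AB by simp
  qed
  obtain B' where B': "B * B' = 1\<^sub>m n" "B' * B = 1\<^sub>m (dim_row B')"
    using B_invertible Bc by (auto simp: invertible_mat_def inverts_mat_def)
  have B'c: "B' \<in> carrier_mat n n"
    using arg_cong[OF B'(1), of dim_col] arg_cong[OF B'(2), of dim_col] Bc by auto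
  have minor: "principal_minor2 B i j \<noteq> 0" if e: "{i, j} \<in> edges ?T" for i j
    using edge_minor_nonzero[OF GT vT B_treeangle Bc B'c B'(1) e] edge_nonzero[of i j] diag[OF e] e
      edgeT_less[OF e] by (simp add: AB edgeT)
  have d_minor: "d i j = principal_minor2 B i j" if "i < n" "j < n" for i j
    using that by (simp add: d principal_minor2_def AB)
  define C where "C = tree_inverse ?T B"
  have C: "C \<in> carrier_mat n n" using Bc by (simp add: C_def tree_inverse_def)
  have BC: "B * C = 1\<^sub>m n"
    unfolding C_def using end_T AB by (intro mult_tree_inverse[OF T vT B_treeangle Bc minor]) auto
  have CB: "C * B = 1\<^sub>m n" using mat_mult_left_right_inverse[OF Bc C BC] .
  have C_off: "C $$ (i, j) \<noteq> 0 \<longleftrightarrow> {i, j} \<in> edges ?T \<and> A $$ (i, j) \<noteq> 0"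
    if "i < n" "j < n" "i \<noteq> j" for i j
    using that Bc minor[of i j] by (simp add: C_def tree_inverse_def AB)
  have C_rr: "C $$ (r, r) = s"
  proof -
    have "A $$ (r, k) * A $$ (k, r) / d r k = B $$ (r, k) * B $$ (k, r) / principal_minor2 B r k"
      if "k \<in> neighbours ?T r" for k
      using that rn vT by (auto simp: AB d_minor neighbours_def)
    then show ?thesis
      using rn Bc arr by (simp add: C_def tree_inverse_def AB s nbr_T[OF rn])
  qed

  \<comment> \<open>Every path to \<open>n\<close> ends with \<open>r, n\<close>, so the treeangle identities at \<open>r\<close> make the last
    column and the last row of \<open>A\<close> multiples of those of \<open>r\<close>.\<close>
  define \<alpha> \<beta> where "\<alpha> = A $$ (r, n) / A $$ (r, r)" and "\<beta> = A $$ (n, r) / A $$ (r, r)"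
  have column: "A $$ (i, n) = \<alpha> * A $$ (i, r)" and row: "A $$ (n, i) = \<beta> * A $$ (r, i)"
    if "i < n" for i
  proof -
    have "i \<in> verts \<Gamma>" "n \<in> verts \<Gamma>" "i \<noteq> n" using that verts by auto
    then obtain p where p: "path_joining \<Gamma> i p n" "r \<in> set p"
      using path_to_pendant_meets_neighbour[OF G\<Gamma> nbr_n] by blast
    show "A $$ (i, n) = \<alpha> * A $$ (i, r)"
      using treeangleD[OF treeangle p] arr by (simp add: \<alpha>_def field_simps)
    show "A $$ (n, i) = \<beta> * A $$ (r, i)"
      using treeangleD[OF treeangle path_joining_rev[OF p(1)], of r] p(2) arr
      by (simp add: \<beta>_def field_simps)
  qed
  have corner: "A $$ (n, n) = \<alpha> * A $$ (n, r)"
    by (rule singular_corner[OF rn A singular Bc C CB AB column])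
  let ?f = "border_index n r"
  have border: "A $$ (i, j) = border_coeff n \<beta> i * B $$ (?f i, ?f j) * border_coeff n \<alpha> j"
    if "i < n + 1" "j < n + 1" for i j
    using that rn column row corner
    by (auto simp: border_coeff_def border_index_def AB less_Suc_eq)
  let ?X = "moore_penrose A"
  have Xc: "?X \<in> carrier_mat (n + 1) (n + 1)"
    using moore_penrose_bordered(1)[OF rn A Bc C BC] border by blast
  have X: "?X $$ (i, j) \<noteq> 0 \<longleftrightarrow>
      C $$ (?f i, ?f j) \<noteq> 0 \<and> (i = n \<longrightarrow> A $$ (r, n) \<noteq> 0) \<and> (j = n \<longrightarrow> A $$ (n, r) \<noteq> 0)"
    if "i < n + 1" "j < n + 1" for i j
    using moore_penrose_bordered(2)[OF rn A Bc C BC border, simplified, OF that[simplified]] arr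
    by (auto simp: border_pinv_coeff_eq_0_iff \<alpha>_def \<beta>_def)

  \<comment> \<open>As \<open>border_index\<close> sends \<open>n\<close> to \<open>r\<close>, the pair \<open>{r, n}\<close> is governed by the diagonal entry
    \<open>s\<close> of \<open>C\<close>, and any other pair \<open>{j, n}\<close> by the entries of \<open>C\<close> at \<open>{j, r}\<close>.\<close>
  have GE: "{i, j} \<in> edges G \<longleftrightarrow> ?X $$ (i, j) \<noteq> 0 \<or> ?X $$ (j, i) \<noteq> 0"
    if "i < n + 1" "j < n + 1" "i \<noteq> j" for i j
    using that Xc by (auto simp: G matrix_graph_def doubleton_eq_iff)
  have inner: "{i, j} \<in> edges G \<longleftrightarrow> {i, j} \<in> edges \<Gamma>" if ij: "i < n" "j < n" "i \<noteq> j" for i j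
    using ij edge_nonzero[of i j] C_off[OF ij] C_off[of j i]
    by (auto simp: GE X border_index_def edgeT insert_commute)
  have r_or: "A $$ (r, n) \<noteq> 0 \<or> A $$ (n, r) \<noteq> 0"
    using edge_nonzero[of r n] edge_n by simp
  have outer_r: "{r, n} \<in> edges G \<longleftrightarrow> s \<noteq> 0"
    using rn r_or by (auto simp: GE X border_index_def C_rr)
  have outer: "{j, n} \<in> edges G \<longleftrightarrow> {j, n} \<in> H" if "j < n" "j \<noteq> r" for j
  proof -
    have nb: "j \<in> neighbours \<Gamma> r - {n} \<longleftrightarrow> {j, r} \<in> edges ?T"
      using that rn by (auto simp: nbr\<Gamma> edgeT)
    have "{j, n} \<in> N' \<longleftrightarrow> C $$ (j, r) \<noteq> 0" "{j, n} \<in> N'' \<longleftrightarrow> C $$ (r, j) \<noteq> 0"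
      using that rn nb C_off[of j r] C_off[of r j]
      by (auto simp: N' N'' doubleton_eq_iff insert_commute)
    moreover have "{j, n} \<in> edges G \<longleftrightarrow>
        (A $$ (n, r) \<noteq> 0 \<and> C $$ (j, r) \<noteq> 0) \<or> (A $$ (r, n) \<noteq> 0 \<and> C $$ (r, j) \<noteq> 0)"
      using that by (auto simp: GE X border_index_def)
    ultimately show ?thesis using r_or H_a H_b H_c by auto
  qed
  have H_sub: "H \<subseteq> N' \<union> N''" using r_or H_a H_b H_c by auto
  have H_form: "\<exists>j<n. j \<noteq> r \<and> e = {j, n}" if eH: "e \<in> H" for e
  proof -
    obtain j where j: "{j, r} \<in> edges \<Gamma>" "j \<noteq> n" "e = {j, n}"
      using eH H_sub unfolding N' N'' nbr\<Gamma>[symmetric] by blast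
    then have "j < n" "j \<noteq> r" using simple_edgeD[OF G\<Gamma>(1) j(1)] verts by simp_all
    then show ?thesis using j(3) by blast
  qed

  have pair: "\<exists>i j. i < j \<and> j \<le> n \<and> e = {i, j}" if e: "e \<in> edges G \<or> e \<in> edges \<Gamma> \<or> e \<in> H" for e
  proof -
    have "\<exists>i j. i < n + 1 \<and> j < n + 1 \<and> i \<noteq> j \<and> e = {i, j}"
      using e
    proof (elim disjE)
      assume "e \<in> edges G"
      then show ?thesis using Xc by (auto simp: G matrix_graph_def)
    next
      assume "e \<in> edges \<Gamma>"
      then obtain i j where ij: "e = {i, j}" using G\<Gamma>(1) by (auto simp: simple_graph_def)
      with \<open>e \<in> edges \<Gamma>\<close> have "{i, j} \<in> edges \<Gamma>" by simp
      from simple_edgeD[OF G\<Gamma>(1) this] ij show ?thesis using verts by auto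
    next
      assume "e \<in> H"
      then obtain j where "j < n" "e = {j, n}" using H_form by blast
      then show ?thesis by (intro exI[of _ j] exI[of _ n]) simp
    qed
    then obtain i j where "i \<le> n" "j \<le> n" "i < j \<or> j < i" "e = {i, j}"
      using less_Suc_eq_le by (metis Suc_eq_plus1 linorder_neqE_nat)
    then show ?thesis using insert_commute by blast
  qed
  have member: "{i, j} \<in> edges G \<longleftrightarrow>
      ({i, j} \<in> edges \<Gamma> \<and> ({i, j} = {r, n} \<longrightarrow> s \<noteq> 0)) \<or> {i, j} \<in> H" if ij: "i < j" "j \<le> n" for i j
  proof (cases "j = n")
    case True
    have "{r, n} \<notin> H" using H_form[of "{r, n}"] rn by (auto simp: doubleton_eq_iff)
    then show ?thesis
      using True ij rn outer outer_r edge_n by (cases "i = r") (auto simp: doubleton_eq_iff)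
  next
    case False
    then have "{i, j} \<notin> H" using H_form[of "{i, j}"] ij by (auto simp: doubleton_eq_iff)
    then show ?thesis using False ij inner by (auto simp: doubleton_eq_iff)
  qed
  have "edges G = (if s = 0 then edges \<Gamma> - {{r, n}} else edges \<Gamma>) \<union> H" (is "_ = ?E")
  proof (rule Set.set_eqI)
    fix e
    show "e \<in> edges G \<longleftrightarrow> e \<in> ?E"
    proof (cases "\<exists>i j. i < j \<and> j \<le> n \<and> e = {i, j}")
      case True
      then show ?thesis using member by auto
    next
      case False
      then have "e \<notin> edges G" "e \<notin> edges \<Gamma>" "e \<notin> H" using pair by blast+
      then show ?thesis by simp
    qed
  qed
  moreover have "d i j \<noteq> 0" if "{i, j} \<in> edges ?T" for i j
    using minor[OF that] d_minor edgeT_less[OF that] by simp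
  ultimately show ?thesis by simp
qed

end
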